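(* Every (nonempty) skeletal digraph is peo-consistent.
   Context: Digraphs are finite, without loops, parallel or antiparallel arcs. The transitive reduction of a digraph is obtained by removing all arcs $u\to v$ for which there is another directed path (of length at least $2$) from $u$ to $v$. An oriented forest is a digraph whose underlying undirected graph is a forest. A digraph $D$ is vertebrate if the transitive reduction of every induced subgraph of $D$ is an oriented forest (such $D$ is necessarily acyclic). A digraph $D$ is filled if for any directed path $v_1\to\cdots\to v_k$ in $D$, if the arc $v_1\to v_k$ belongs to $D$, then all arcs $v_i\to v_j$, $1\le i<j\le k$, belong to $D$. A digraph is skeletal if it is both vertebrate and filled. A digraph $D$ is peo-consistent if its vertices can be labeled $1,\ldots,n$ such that either $n=1$, or (i) the vertex $n$ is a source or a sink of $D$ (all arcs incident with it are outgoing, or all are incoming), (ii) the vertex $n$ is simplicial in the underlying undirected graph of $D$ (its neighborhood is a clique), and (iii) $D-n$ (with the labels $1,\ldots,n-1$) is peo-consistent. *)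

theory Defs
  imports "Graph_Theory.Graph_Theory"
begin

text \<open>The locale \<^locale>\<open>digraph\<close> covers finiteness and the absence of loops and parallel arcs.\<close>

locale oriented_graph = digraph +
  assumes no_antiparallel: "u \<rightarrow>\<^bsub>G\<^esub> v \<Longrightarrow> \<not> v \<rightarrow>\<^bsub>G\<^esub> u"

definition transitive_reduction :: "('a,'b) pre_digraph \<Rightarrow> ('a,'b) pre_digraph" where
  "transitive_reduction G =
     G\<lparr>arcs := {e \<in> arcs G. \<not> (\<exists>p. vpath p G \<and> hd p = tail G e \<and> last p = head G e
                                     \<and> vwalk_length p \<ge> 2)}\<rparr>"

text \<open>
  The underlying undirected graph is represented by \<^const>\<open>mk_symmetric\<close>. Every edge of it
  yields a directed cycle \<open>a, b, a\<close>, so the undirected cycles are exactly the directed cycles of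
  length at least 3. The library's \<^const>\<open>forest\<close> forbids all directed cycles and is therefore
  not suitable.
\<close>

definition oriented_forest :: "('a,'b) pre_digraph \<Rightarrow> bool" where
  "oriented_forest G \<longleftrightarrow>
     \<not> (\<exists>p. pre_digraph.cycle (with_proj (mk_symmetric G)) p \<and> length p \<ge> 3)"

definition vertebrate :: "('a,'b) pre_digraph \<Rightarrow> bool" where
  "vertebrate G \<longleftrightarrow> (\<forall>H. induced_subgraph H G \<longrightarrow> oriented_forest (transitive_reduction H))"

definition filled :: "('a,'b) pre_digraph \<Rightarrow> bool" where
  "filled G \<longleftrightarrow>
     (\<forall>p. vpath p G \<and> hd p \<rightarrow>\<^bsub>G\<^esub> last p \<longrightarrow> (\<forall>i j. i < j \<and> j < length p \<longrightarrow> p ! i \<rightarrow>\<^bsub>G\<^esub> p ! j))"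

definition skeletal :: "('a,'b) pre_digraph \<Rightarrow> bool" where
  "skeletal G \<longleftrightarrow> vertebrate G \<and> filled G"

definition source :: "('a,'b) pre_digraph \<Rightarrow> 'a \<Rightarrow> bool" where
  "source G v \<longleftrightarrow> in_arcs G v = {}"

definition sink :: "('a,'b) pre_digraph \<Rightarrow> 'a \<Rightarrow> bool" where
  "sink G v \<longleftrightarrow> out_arcs G v = {}"

definition neighborhood :: "('a,'b) pre_digraph \<Rightarrow> 'a \<Rightarrow> 'a set" where
  "neighborhood G v = {u. v \<rightarrow>\<^bsub>with_proj (mk_symmetric G)\<^esub> u}"

definition clique :: "('a,'b) pre_digraph \<Rightarrow> 'a set \<Rightarrow> bool" where
  "clique G S \<longleftrightarrow>
     S \<subseteq> verts G \<and> (\<forall>u\<in>S. \<forall>w\<in>S. u \<noteq> w \<longrightarrow> u \<rightarrow>\<^bsub>with_proj (mk_symmetric G)\<^esub> w)"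

definition simplicial :: "('a,'b) pre_digraph \<Rightarrow> 'a \<Rightarrow> bool" where
  "simplicial G v \<longleftrightarrow> clique G (neighborhood G v)"

text \<open>
  In \<open>peo_consistent_labeling n v G\<close>, the vertex with label \<open>i\<close> is \<open>v i\<close>, and \<open>n\<close> is the number of
  vertices of \<open>G\<close>. The empty digraph is not peo-consistent.
\<close>

primrec peo_consistent_labeling :: "nat \<Rightarrow> (nat \<Rightarrow> 'a) \<Rightarrow> ('a,'b) pre_digraph \<Rightarrow> bool" where
  "peo_consistent_labeling 0 v G \<longleftrightarrow> False"
| "peo_consistent_labeling (Suc n) v G \<longleftrightarrow>
     bij_betw v {1..Suc n} (verts G) \<and>
     (Suc n = 1 \<or>
      (source G (v (Suc n)) \<or> sink G (v (Suc n))) \<and>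
      simplicial G (v (Suc n)) \<and>
      peo_consistent_labeling n v (pre_digraph.del_vert G (v (Suc n))))"

definition peo_consistent :: "('a,'b) pre_digraph \<Rightarrow> bool" where
  "peo_consistent G \<longleftrightarrow> (\<exists>v. peo_consistent_labeling (card (verts G)) v G)"

end

theory Submission
  imports Defs
begin

text \<open>
  The proof adapts Dirac's theorem on simplicial vertices of chordal graphs. Chordality holds because
  in a filled digraph an arc \<open>u \<rightarrow> w\<close> can only disappear in the transitive reduction if some vertex
  \<open>m\<close> satisfies \<open>u \<rightarrow> m \<rightarrow> w\<close>, so a triangle-free cycle would survive in a transitive reduction.
  One shows by induction that if \<open>v\<close> has a non-neighbour, then some simplicial source or sink is not
  adjacent to \<open>v\<close>. Let \<open>C\<close> be a component of the non-neighbours of \<open>v\<close> and let \<open>S\<close> be its set of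
  neighbours outside \<open>C\<close>; by chordality \<open>S\<close> is a clique. A simplicial source or sink of the digraph
  induced on \<open>C \<union> S\<close> that lies in \<open>C\<close> remains one in the whole digraph. If \<open>C \<union> S\<close> is not a clique,
  applying the induction hypothesis at most twice yields such a vertex. Otherwise \<open>C \<union> S\<close> is a
  transitive tournament, and it suffices that its first or last vertex is in \<open>C\<close>; if both were
  in \<open>S\<close>, they would be common neighbours of \<open>v\<close> and of the vertices of \<open>C\<close>, which every orientation of
  the arcs at \<open>v\<close> contradicts.
\<close>

text \<open>
  If \<open>A\<close> is the arc relation of a skeletal digraph, the pairs occurring in \<open>no_cover_cycle\<close> are edges
  of the transitive reduction of the subgraph induced on \<open>set xs\<close>.
\<close>

locale skeletal_relation =
  fixes A :: "'a \<Rightarrow> 'a \<Rightarrow> bool"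
  assumes asym: "A x y \<Longrightarrow> \<not> A y x"
    and fill: "A a b \<Longrightarrow> A b c \<Longrightarrow> A c d \<Longrightarrow> A a d \<Longrightarrow> A a c \<and> A b d"
    and no_cover_cycle: "distinct xs \<Longrightarrow> 3 \<le> length xs \<Longrightarrow>
      successively (\<lambda>x y. (A x y \<and> \<not> (\<exists>m\<in>set xs. A x m \<and> A m y)) \<or>
                          (A y x \<and> \<not> (\<exists>m\<in>set xs. A y m \<and> A m x))) (xs @ [hd xs]) \<Longrightarrow> False"
begin

section \<open>Forbidden small configurations and cliques\<close>

definition adj :: "'a \<Rightarrow> 'a \<Rightarrow> bool" where
  "adj x y \<longleftrightarrow> A x y \<or> A y x"

text \<open>A simplicial source or sink of the subgraph induced on \<open>W\<close>. Relativizing to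
  \<open>W\<close> lets the induction run over vertex sets while the arc relation stays
  fixed.\<close>

definition good :: "'a set \<Rightarrow> 'a \<Rightarrow> bool" where
  "good W z \<longleftrightarrow> z \<in> W \<and> ((\<forall>x\<in>W. \<not> A x z) \<or> (\<forall>x\<in>W. \<not> A z x)) \<and>
     (\<forall>x\<in>W. \<forall>y\<in>W. adj x z \<longrightarrow> adj y z \<longrightarrow> x \<noteq> y \<longrightarrow> adj x y)"

lemma adj_sym: "adj x y \<Longrightarrow> adj y x"
  by (auto simp: adj_def)

lemma irrefl: "\<not> A x x"
  using asym by blast

lemma adj_irrefl: "\<not> adj x x"
  using irrefl by (auto simp: adj_def)

text \<open>A midpoint of one of the three arcs would have to be the third vertex, which gives
  antiparallel arcs. So the triangle is a cycle excluded by \<open>no_cover_cycle\<close>.\<close>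

lemma no_directed_triangle:
  assumes "A x y" "A y z"
  shows "\<not> A z x"
proof
  assume "A z x"
  have "x \<noteq> y" "y \<noteq> z" "x \<noteq> z"
    using assms asym irrefl by blast+
  then show False
    using no_cover_cycle[of "[x, y, z]"] assms \<open>A z x\<close> asym irrefl by auto
qed

text \<open>Otherwise no arc of the 4-cycle \<open>s, a, t, b\<close> has a midpoint on it, whether
  or not \<open>s\<close> and \<open>t\<close> are adjacent.\<close>

lemma diamond_adj:
  assumes "A s a" "A a t" "A s b" "A b t" "a \<noteq> b"
  shows "adj a b"
proof (rule ccontr)
  assume nadj: "\<not> adj a b"
  have "s \<noteq> a" "a \<noteq> t" "s \<noteq> b" "b \<noteq> t" "s \<noteq> t" "\<not> A a s" "\<not> A t a" "\<not> A b s" "\<not> A t b"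
    using assms asym irrefl by blast+
  then show False
    using no_cover_cycle[of "[s, a, t, b]"] assms nadj irrefl by (auto simp: adj_def)
qed

text \<open>If the inserted vertex \<open>x\<close> precedes the old first vertex \<open>s\<close>,
  it precedes every other \<open>y\<close>, since otherwise \<open>x, s, y\<close> is a directed
  triangle.\<close>

lemma clique_has_first:
  assumes "finite K" "K \<noteq> {}" "\<And>x y. x \<in> K \<Longrightarrow> y \<in> K \<Longrightarrow> x \<noteq> y \<Longrightarrow> adj x y"
  shows "\<exists>s\<in>K. \<forall>x\<in>K. x \<noteq> s \<longrightarrow> A s x"
  using assms
proof (induction rule: finite_ne_induct)
  case (insert x K)
  then obtain s where s: "s \<in> K" "\<forall>y\<in>K. y \<noteq> s \<longrightarrow> A s y"
    by auto
  have ad: "adj x y" if "y \<in> K" for y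
    using that insert by auto
  show ?case
  proof (cases "A s x")
    case False
    then have xs: "A x s"
      using ad[OF s(1)] by (auto simp: adj_def)
    have "A x y" if "y \<in> K" for y
      using ad[OF that] no_directed_triangle[OF xs, of y] s that xs by (auto simp: adj_def)
    then show ?thesis by auto
  qed (use s in auto)
qed auto

lemma clique_has_last:
  assumes "finite K" "K \<noteq> {}" "\<And>x y. x \<in> K \<Longrightarrow> y \<in> K \<Longrightarrow> x \<noteq> y \<Longrightarrow> adj x y"
  shows "\<exists>t\<in>K. \<forall>x\<in>K. x \<noteq> t \<longrightarrow> A x t"
  using assms
proof (induction rule: finite_ne_induct)
  case (insert x K)
  then obtain t where t: "t \<in> K" "\<forall>y\<in>K. y \<noteq> t \<longrightarrow> A y t"
    by auto
  have ad: "adj x y" if "y \<in> K" for y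
    using that insert by auto
  show ?case
  proof (cases "A x t")
    case False
    then have tx: "A t x"
      using ad[OF t(1)] by (auto simp: adj_def)
    have "A y x" if "y \<in> K" for y
      using ad[OF that] no_directed_triangle[of y t x] t that tx by (auto simp: adj_def)
    then show ?thesis by auto
  qed (use t in auto)
qed auto

section \<open>Chordality\<close>

text \<open>A midpoint on the cycle of one of its arcs would form a triangle with the two ends of
  that arc.\<close>

lemma no_triangle_free_cycle:
  assumes "distinct c" "3 \<le> length c" "successively adj (c @ [hd c])"
    and tf: "\<And>x y z. x \<in> set c \<Longrightarrow> y \<in> set c \<Longrightarrow> z \<in> set c \<Longrightarrow> adj x y \<Longrightarrow> adj y z \<Longrightarrow> adj x z \<Longrightarrow> False"
  shows False
proof (rule no_cover_cycle[OF assms(1,2)])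
  have "c \<noteq> []" using assms(2) by auto
  then have "set (c @ [hd c]) = set c" by auto
  then show "successively (\<lambda>x y. (A x y \<and> \<not> (\<exists>m\<in>set c. A x m \<and> A m y)) \<or>
                          (A y x \<and> \<not> (\<exists>m\<in>set c. A y m \<and> A m x))) (c @ [hd c])"
    by (intro successively_mono[OF assms(3)]) (use tf in \<open>unfold adj_def, metis\<close>)
qed

text \<open>A shortest walk from \<open>x\<close> to \<open>y\<close> through \<open>C\<close> is a
  chordless path. Closed through \<open>v\<close>, it would be a triangle-free cycle if
  \<open>x\<close> and \<open>y\<close> were not adjacent.\<close>

lemma common_neighbours_of_outside_vertex_adj:
  assumes ex: "\<exists>q. q \<noteq> [] \<and> hd q = x \<and> last q = y \<and> set q \<subseteq> insert x (insert y C) \<and> successively adj q"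
    and vC: "v \<notin> C" "\<And>c. c \<in> C \<Longrightarrow> \<not> adj v c"
    and vxy: "adj v x" "adj v y" "x \<noteq> y"
  shows "adj x y"
proof (rule ccontr)
  assume nadj: "\<not> adj x y"
  define P where "P q \<longleftrightarrow> q \<noteq> [] \<and> hd q = x \<and> last q = y \<and> set q \<subseteq> insert x (insert y C) \<and> successively adj q" for q
  obtain q where q: "P q" and min: "\<And>r. P r \<Longrightarrow> length q \<le> length r"
    using ex ex_has_least_nat[of P _ length] unfolding P_def by metis
  have qD: "q \<noteq> []" "hd q = x" "last q = y" "set q \<subseteq> insert x (insert y C)" "successively adj q"
    using q by (auto simp: P_def)
  \<comment> \<open>A chord or a repeated vertex would give a shortcut, contradicting minimality.\<close>
  have close: "j \<le> i + 1" if ij: "i < j" "j < length q" "adj (q ! i) (q ! j)" for i j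
  proof (rule ccontr)
    assume "\<not> j \<le> i + 1"
    let ?r = "take (Suc i) q @ drop j q"
    have "successively adj (take (Suc i) q)" "successively adj (drop j q)"
      using qD(5) by (metis append_take_drop_id successively_append_iff)+
    moreover have "last (take (Suc i) q) = q ! i" "hd (drop j q) = q ! j"
      using ij by (simp_all add: take_Suc_conv_app_nth hd_drop_conv_nth)
    ultimately have "successively adj ?r"
      using ij by (simp add: successively_append_iff)
    moreover have "set ?r \<subseteq> set q"
      using set_take_subset set_drop_subset by fastforce
    ultimately have "P ?r"
      using qD ij by (auto simp: P_def)
    from min[OF this] show False
      using ij \<open>\<not> j \<le> i + 1\<close> by auto
  qed
  have dist: "q ! i \<noteq> q ! j" if ij: "i < j" "j < length q" for i j
  proof
    assume eq: "q ! i = q ! j"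
    let ?r = "take (Suc i) q @ drop (Suc j) q"
    have "successively adj (take (Suc i) q)"
      using qD(5) by (metis append_take_drop_id successively_append_iff)
    moreover have "q = take (Suc j) q @ drop (Suc j) q" and ne: "take (Suc j) q \<noteq> []"
      using ij by auto
    then have "successively adj (drop (Suc j) q)"
       "drop (Suc j) q \<noteq> [] \<Longrightarrow> adj (last (take (Suc j) q)) (hd (drop (Suc j) q))"
      using qD(5) ne by (metis successively_append_iff)+
    moreover have "last (take (Suc i) q) = q ! i" "last (take (Suc j) q) = q ! j"
      using ij by (simp_all add: take_Suc_conv_app_nth)
    ultimately have "successively adj ?r"
      using ij eq by (auto simp: successively_append_iff)
    moreover have "set ?r \<subseteq> set q"
      using set_take_subset set_drop_subset by fastforce
    moreover have "last ?r = y"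
    proof (cases "Suc j < length q")
      case False
      then have "j = length q - 1" using ij by auto
      then show ?thesis
        using \<open>last (take (Suc i) q) = q ! i\<close> eq qD False by (auto simp: last_conv_nth)
    qed (use qD in auto)
    ultimately have "P ?r"
      using qD ij by (auto simp: P_def)
    from min[OF this] show False
      using ij by auto
  qed
  \<comment> \<open>Three positions cannot pairwise differ by exactly 1, so this rules out triangles
    inside \<open>q\<close>.\<close>
  have close': "i \<le> j + 1 \<and> j \<le> i + 1 \<and> i \<noteq> j" if "i < length q" "j < length q" "adj (q ! i) (q ! j)" for i j
    using close[of i j] close[of j i] that adj_sym[OF that(3)] adj_irrefl
    by (cases i j rule: linorder_cases) auto
  have distinct: "distinct q"
    using dist by (metis distinct_conv_nth linorder_neqE_nat)
  have vq: "v \<notin> set q"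
    using qD(4) vC(1) vxy adj_irrefl by auto
  have len: "2 \<le> length q"
    using qD vxy(3) by (cases q; cases "tl q") auto
  show False
  proof (rule no_triangle_free_cycle[of "v # q"])
    show "successively adj ((v # q) @ [hd (v # q)])"
      using qD vxy adj_sym[OF vxy(2)] by (auto simp: successively_append_iff successively_Cons)
    fix a b c
    assume mem: "a \<in> set (v # q)" "b \<in> set (v # q)" "c \<in> set (v # q)"
      and tri: "adj a b" "adj b c" "adj a c"
    \<comment> \<open>On the cycle \<open>v\<close> has only the neighbours \<open>x\<close> and
      \<open>y\<close>, which are not adjacent to each other, so no triangle contains
      \<open>v\<close>.\<close>
    have vn: "c' = x \<or> c' = y" if "c' \<in> set (v # q)" "adj v c'" for c'
      using that qD(4) vC adj_irrefl by auto
    have "v \<notin> {a, b, c}"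
      using vn mem tri nadj adj_sym adj_irrefl by (metis insertE empty_iff)
    then have "a \<in> set q" "b \<in> set q" "c \<in> set q"
      using mem by auto
    then obtain i j k where "i < length q" "j < length q" "k < length q" "a = q ! i" "b = q ! j" "c = q ! k"
      by (metis in_set_conv_nth)
    then show False
      using close'[of i j] close'[of j k] close'[of i k] tri by auto
  qed (use distinct vq len in auto)
qed

section \<open>Dirac's argument for simplicial sources and sinks\<close>

text \<open>Prescribing the vertex to be avoided makes the induction work: inside the smaller set
  \<open>H\<close>, a new choice of this vertex steers the result into \<open>C\<close>.\<close>

lemma good_if_nonadjacent:
  assumes "finite W" "v \<in> W" "u \<in> W" "u \<noteq> v" "\<not> adj u v"
  shows "\<exists>z. good W z \<and> z \<noteq> v \<and> \<not> adj z v"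
  using assms
proof (induction W arbitrary: u v rule: finite_psubset_induct)
  case (psubset W)
  define N where "N = {x \<in> W. x \<noteq> v \<and> \<not> adj x v}"
  define R where "R = {(x, y). x \<in> N \<and> y \<in> N \<and> adj x y}"
  define C where "C = R\<^sup>* `` {u}"
  define S where "S = {x \<in> W. adj x v \<and> (\<exists>c\<in>C. adj x c)}"
  define H where "H = C \<union> S"
  have uN: "u \<in> N" and uC: "u \<in> C"
    using psubset by (auto simp: N_def C_def)
  have CN: "C \<subseteq> N"
  proof
    fix c assume "c \<in> C"
    then have "(u, c) \<in> R\<^sup>*" by (simp add: C_def)
    then show "c \<in> N" by induction (use uN in \<open>auto simp: R_def\<close>)
  qed
  have C_closed: "y \<in> C" if "x \<in> C" "y \<in> N" "adj x y" for x y
    using that CN by (auto simp: C_def R_def intro: rtrancl.rtrancl_into_rtrancl)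
  have walk: "\<exists>q. q \<noteq> [] \<and> hd q = a \<and> last q = b \<and> set q \<subseteq> C \<and> successively adj q"
    if ab: "a \<in> C" "b \<in> C" for a b
  proof -
    have "sym R" by (auto simp: R_def sym_def intro: adj_sym)
    then have "(a, u) \<in> R\<^sup>*"
      using ab(1) by (auto simp: C_def dest: sym_rtrancl symD)
    then have "(a, b) \<in> R\<^sup>*"
      using ab(2) by (auto simp: C_def)
    then show ?thesis
    proof induction
      case base
      show ?case using ab by (intro exI[of _ "[a]"]) auto
    next
      case (step y z)
      then obtain q where q: "q \<noteq> []" "hd q = a" "last q = y" "set q \<subseteq> C" "successively adj q"
        by auto
      have "y \<in> C" using q by auto
      then have "z \<in> C" using step C_closed by (auto simp: R_def)
      then show ?case using q step
        by (intro exI[of _ "q @ [z]"]) (auto simp: successively_append_iff R_def)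
    qed
  qed
  have S_clique: "adj x y" if xy: "x \<in> S" "y \<in> S" "x \<noteq> y" for x y
  proof (rule common_neighbours_of_outside_vertex_adj[of x y C v])
    obtain a b where ab: "a \<in> C" "b \<in> C" "adj x a" "adj y b"
      using xy by (auto simp: S_def)
    obtain q where "q \<noteq> []" "hd q = a" "last q = b" "set q \<subseteq> C" "successively adj q"
      using walk ab by blast
    then show "\<exists>q. q \<noteq> [] \<and> hd q = x \<and> last q = y \<and> set q \<subseteq> insert x (insert y C) \<and> successively adj q"
      using ab by (intro exI[of _ "x # q @ [y]"])
        (auto simp: successively_append_iff successively_Cons intro: adj_sym)
  qed (use CN xy in \<open>auto simp: N_def S_def intro: adj_sym\<close>)
  \<comment> \<open>The inclusion is strict because \<open>v\<close> is in neither \<open>N\<close>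
    nor \<open>S\<close>.\<close>
  have HW: "H \<subset> W"
    using CN psubset.prems adj_irrefl by (auto simp: H_def S_def N_def)
  have finH: "finite H"
    using HW psubset.hyps finite_subset by blast
  \<comment> \<open>A neighbour in \<open>W\<close> of a vertex of \<open>C\<close> is either a
    non-neighbour of \<open>v\<close>, hence in \<open>C\<close>, or a neighbour of
    \<open>v\<close>, hence in \<open>S\<close>. Thus vertices of \<open>C\<close> have the same
    neighbours in \<open>H\<close> as in \<open>W\<close>.\<close>
  have nbr: "x \<in> H" if "x \<in> W" "z \<in> C" "adj x z" for x z
    using that CN C_closed[of z x] by (auto simp: H_def S_def N_def intro: adj_sym)
  have lift: "\<exists>z. good W z \<and> z \<noteq> v \<and> \<not> adj z v" if z: "z \<in> C" "good H z" for z
  proof (intro exI[of _ z] conjI)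
    show "z \<noteq> v" "\<not> adj z v" using CN z by (auto simp: N_def)
    have "\<And>x. x \<in> W \<Longrightarrow> A x z \<or> A z x \<Longrightarrow> x \<in> H"
      using nbr z by (auto simp: adj_def)
    then show "good W z"
      using z HW unfolding good_def adj_def by blast
  qed
  show ?case
  proof (cases "\<forall>x\<in>H. \<forall>y\<in>H. x \<noteq> y \<longrightarrow> adj x y")
    case True
    then have K: "\<And>x y. x \<in> H \<Longrightarrow> y \<in> H \<Longrightarrow> x \<noteq> y \<Longrightarrow> adj x y" by blast
    have "H \<noteq> {}" using uC by (auto simp: H_def)
    obtain s t where s: "s \<in> H" "\<forall>x\<in>H. x \<noteq> s \<longrightarrow> A s x" and t: "t \<in> H" "\<forall>x\<in>H. x \<noteq> t \<longrightarrow> A x t"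
      using clique_has_first[OF finH \<open>H \<noteq> {}\<close> K] clique_has_last[OF finH \<open>H \<noteq> {}\<close> K] by metis
    have "good H s" "good H t"
      using s t asym irrefl K unfolding good_def by metis+
    moreover have "s \<in> C \<or> t \<in> C"
    proof (rule ccontr)
      assume "\<not> (s \<in> C \<or> t \<in> C)"
      then have st: "s \<in> S" "t \<in> S" "u \<noteq> s" "u \<noteq> t"
        using s t uC by (auto simp: H_def)
      have uH: "u \<in> H" using uC by (simp add: H_def)
      have sut: "A s u" "A u t" using s t st uH by auto
      then have "s \<noteq> t" using asym by blast
      then have "A s t" using s t by auto
      have uv: "\<not> A u v" "\<not> A v u" "u \<noteq> v" using psubset.prems by (auto simp: adj_def)
      have "A s v \<or> A v s" "A t v \<or> A v t"
        using st by (auto simp: S_def adj_def)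
      \<comment> \<open>In the first three cases \<open>u\<close> and \<open>v\<close> become
        adjacent: by the diamond from \<open>s\<close> to \<open>t\<close>, by filling the path
        \<open>v, s, u, t\<close>, and by filling \<open>s, u, t, v\<close>. The fourth gives the
        directed triangle \<open>s, t, v\<close>.\<close>
      then consider "A s v" "A v t" | "A v s" "A v t" | "A s v" "A t v" | "A v s" "A t v" by blast
      then show False
      proof cases
        case 1 then show ?thesis using diamond_adj[OF sut, of v] uv by (auto simp: adj_def)
      next
        case 2 then show ?thesis using fill[of v s u t] sut uv by auto
      next
        case 3 then show ?thesis using fill[of s u t v] sut uv by auto
      next
        case 4 then show ?thesis using no_directed_triangle[OF \<open>A s t\<close>] by auto
      qed
    qed
    ultimately show ?thesis using lift by blast
  next
    case False
    then obtain x x' where x: "x \<in> H" "x' \<in> H" "x' \<noteq> x" "\<not> adj x' x"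
      by metis
    obtain y where y: "good H y" "y \<noteq> x" "\<not> adj y x"
      using psubset.IH[OF HW x] by blast
    show ?thesis
    proof (cases "y \<in> C")
      case True
      then show ?thesis using lift y by blast
    next
      case False
      then have yS: "y \<in> S" "y \<in> H" using y(1) by (auto simp: good_def H_def)
      \<comment> \<open>The second application avoids \<open>y\<close>, with \<open>x\<close> as its
        non-neighbour. Its result is not adjacent to \<open>y\<close>, so it is outside the clique
        \<open>S\<close>.\<close>
      obtain z where z: "good H z" "z \<noteq> y" "\<not> adj z y"
        using psubset.IH[OF HW yS(2) x(1)] y(2,3) by (auto simp: adj_def)
      have "z \<in> H" using z(1) by (simp add: good_def)
      then have "z \<in> C"
        using S_clique[of z y] yS(1) z(2,3) unfolding H_def by blast
      then show ?thesis using lift z by blast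
    qed
  qed
qed

lemma ex_good:
  assumes "finite W" "W \<noteq> {}"
  shows "\<exists>z. good W z"
proof (cases "\<forall>x\<in>W. \<forall>y\<in>W. x \<noteq> y \<longrightarrow> adj x y")
  case True
  then obtain s where "s \<in> W" "\<forall>x\<in>W. x \<noteq> s \<longrightarrow> A s x"
    using clique_has_first[OF assms] by metis
  then have "good W s"
    using True asym irrefl unfolding good_def by metis
  then show ?thesis ..
next
  case False
  then show ?thesis using good_if_nonadjacent[OF assms(1)] by metis
qed

end

section \<open>From skeletal digraphs to the arc relation\<close>

text \<open>Translates vertex lists into the arc lists on which \<open>cycle\<close> is defined; the
  arcs of a pair digraph are the vertex pairs themselves.\<close>

lemma awalk_vwalk_arcs:
  fixes P :: "'a pair_pre_digraph"
  assumes "successively (\<lambda>x y. (x, y) \<in> parcs P) p" "p \<noteq> []"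
  shows "set (vwalk_arcs p) \<subseteq> parcs P"
    and "pre_digraph.cas (with_proj P) (hd p) (vwalk_arcs p) (last p)"
    and "pre_digraph.awalk_verts (with_proj P) (hd p) (vwalk_arcs p) = p"
  using assms
  by (induction p rule: vwalk_arcs.induct)
    (auto simp: pre_digraph.cas.simps pre_digraph.awalk_verts.simps)

lemma oriented_forest_no_cycle:
  assumes "oriented_forest T" "hd c \<in> verts T" "distinct c" "3 \<le> length c"
    and "successively (\<lambda>x y. x \<rightarrow>\<^bsub>T\<^esub> y \<or> y \<rightarrow>\<^bsub>T\<^esub> x) (c @ [hd c])"
  shows False
proof -
  let ?P = "mk_symmetric T"
  have ne: "c \<noteq> []" using assms(4) by auto
  have suc: "successively (\<lambda>x y. (x, y) \<in> parcs ?P) (c @ [hd c])"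
    by (rule successively_mono[OF assms(5)]) (auto simp: parcs_mk_symmetric arcs_ends_conv)
  have "pre_digraph.cycle (with_proj ?P) (vwalk_arcs (c @ [hd c]))"
    unfolding pre_digraph.cycle_def pre_digraph.awalk_def
    using awalk_vwalk_arcs[OF suc] assms ne
    by (intro exI[of _ "hd c"]) (cases c, auto)
  \<comment> \<open>The closed list has one vertex more than \<open>c\<close>, hence as many arcs as
    \<open>c\<close> has vertices.\<close>
  moreover have "length (vwalk_arcs (c @ [hd c])) \<ge> 3"
    using assms(4) by (simp flip: vwalk_length_def)
  ultimately show False
    using assms(1) by (auto simp: oriented_forest_def)
qed

lemma dominates_induce_subgraph:
  "u \<rightarrow>\<^bsub>G \<restriction> W\<^esub> w \<longleftrightarrow> u \<rightarrow>\<^bsub>G\<^esub> w \<and> u \<in> W \<and> w \<in> W"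
  by (auto simp: arcs_ends_conv induce_subgraph_def)

lemma vpath_two_arcsD:
  assumes "vpath p G" "2 \<le> vwalk_length p"
  shows "hd p \<rightarrow>\<^bsub>G\<^esub> p ! 1" "p ! 1 \<in> verts G"
  using assms by (cases p; cases "tl p"; auto simp: vpath_def vwalk_def)+

lemma vpath_induce_subgraph:
  assumes "vpath p (G \<restriction> W)" "W \<subseteq> verts G"
  shows "vpath p G"
  using assms dominates_induce_subgraph[where G = G and W = W] by (auto simp: vpath_def vwalk_def)

text \<open>In a filled digraph the second vertex of any longer path from \<open>u\<close> to
  \<open>w\<close> has an arc to \<open>w\<close>, so it is a midpoint.\<close>

lemma dominates_transitive_reduction:
  assumes "filled G" "W \<subseteq> verts G" "u \<in> W" "w \<in> W" "u \<rightarrow>\<^bsub>G\<^esub> w"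
    and "\<not> (\<exists>m\<in>W. u \<rightarrow>\<^bsub>G\<^esub> m \<and> m \<rightarrow>\<^bsub>G\<^esub> w)"
  shows "u \<rightarrow>\<^bsub>transitive_reduction (G \<restriction> W)\<^esub> w"
proof -
  obtain e where e: "e \<in> arcs G" "tail G e = u" "head G e = w"
    using assms(5) by (auto simp: arcs_ends_conv)
  have "\<not> (\<exists>p. vpath p (G \<restriction> W) \<and> hd p = u \<and> last p = w \<and> vwalk_length p \<ge> 2)"
  proof
    assume "\<exists>p. vpath p (G \<restriction> W) \<and> hd p = u \<and> last p = w \<and> vwalk_length p \<ge> 2"
    then obtain p where p: "vpath p (G \<restriction> W)" "hd p = u" "last p = w" "vwalk_length p \<ge> 2"
      by blast
    have "u \<rightarrow>\<^bsub>G\<^esub> p ! 1" "p ! 1 \<in> W"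
      using vpath_two_arcsD[OF p(1,4)] p(2) by (auto simp: dominates_induce_subgraph)
    moreover have "p ! 1 \<rightarrow>\<^bsub>G\<^esub> p ! (length p - 1)"
      using assms(1,5) p vpath_induce_subgraph[OF p(1) assms(2)] unfolding filled_def by auto
    then have "p ! 1 \<rightarrow>\<^bsub>G\<^esub> w"
      using p by (cases "p = []") (auto simp: last_conv_nth)
    ultimately show False using assms(6) by blast
  qed
  then have "e \<in> arcs (transitive_reduction (G \<restriction> W))"
    using e assms by (auto simp: transitive_reduction_def)
  then show ?thesis
    using e by (auto simp: arcs_ends_conv transitive_reduction_def)
qed

lemma skeletal_relation_dominates:
  assumes "oriented_graph G" "skeletal G"
  shows "skeletal_relation (dominates G)"
proof
  interpret oriented_graph G by fact
  have vert: "vertebrate G" and fill: "filled G"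
    using assms(2) by (auto simp: skeletal_def)
  show asym: "\<not> y \<rightarrow>\<^bsub>G\<^esub> x" if "x \<rightarrow>\<^bsub>G\<^esub> y" for x y
    using no_antiparallel that .
  show "a \<rightarrow>\<^bsub>G\<^esub> c \<and> b \<rightarrow>\<^bsub>G\<^esub> d"
    if arcs: "a \<rightarrow>\<^bsub>G\<^esub> b" "b \<rightarrow>\<^bsub>G\<^esub> c" "c \<rightarrow>\<^bsub>G\<^esub> d" "a \<rightarrow>\<^bsub>G\<^esub> d" for a b c d
  proof -
    \<comment> \<open>Needed because \<open>filled\<close> speaks of paths. Any coincidence would
      give a loop or antiparallel arcs.\<close>
    have "distinct [a, b, c, d]"
      using arcs asym by auto
    then have "vpath [a, b, c, d] G"
      using arcs by (auto simp: vpath_def vwalk_def)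
    then have all: "\<forall>i j. i < j \<and> j < length [a, b, c, d] \<longrightarrow> [a, b, c, d] ! i \<rightarrow>\<^bsub>G\<^esub> [a, b, c, d] ! j"
      using fill arcs unfolding filled_def by (metis last.simps list.sel(1) list.distinct(1))
    show ?thesis
      using all[rule_format, of 0 2] all[rule_format, of 1 3] by simp
  qed
  show False
    if c: "distinct c" "3 \<le> length c"
      and suc: "successively (\<lambda>x y. (x \<rightarrow>\<^bsub>G\<^esub> y \<and> \<not> (\<exists>m\<in>set c. x \<rightarrow>\<^bsub>G\<^esub> m \<and> m \<rightarrow>\<^bsub>G\<^esub> y)) \<or>
        (y \<rightarrow>\<^bsub>G\<^esub> x \<and> \<not> (\<exists>m\<in>set c. y \<rightarrow>\<^bsub>G\<^esub> m \<and> m \<rightarrow>\<^bsub>G\<^esub> x))) (c @ [hd c])" for c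
  proof -
    have "c \<noteq> []" using c(2) by auto
    then have set_eq: "set (c @ [hd c]) = set c" by auto
    \<comment> \<open>A one-element list satisfies \<open>successively\<close> trivially, so nothing
      places its vertex in \<open>G\<close>; hence \<open>butlast\<close>, which turns
      \<open>c @ [hd c]\<close> back into \<open>c\<close>.\<close>
    have in_verts: "set (butlast p) \<subseteq> verts G"
      if "successively (\<lambda>x y. x \<rightarrow>\<^bsub>G\<^esub> y \<or> y \<rightarrow>\<^bsub>G\<^esub> x) p" for p
      using that by (induction p rule: vwalk_arcs.induct) (auto dest: adj_in_verts)
    have "successively (\<lambda>x y. x \<rightarrow>\<^bsub>G\<^esub> y \<or> y \<rightarrow>\<^bsub>G\<^esub> x) (c @ [hd c])"
      by (rule successively_mono[OF suc]) auto
    then have W: "set c \<subseteq> verts G"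
      using in_verts by fastforce
    let ?T = "transitive_reduction (G \<restriction> set c)"
    have "oriented_forest ?T"
      using vert induced_induce[OF W] by (auto simp: vertebrate_def)
    moreover have "hd c \<in> verts ?T"
      using \<open>c \<noteq> []\<close> by (simp add: transitive_reduction_def)
    moreover have "successively (\<lambda>x y. x \<rightarrow>\<^bsub>?T\<^esub> y \<or> y \<rightarrow>\<^bsub>?T\<^esub> x) (c @ [hd c])"
    proof (rule successively_mono[OF suc])
      fix x y
      assume "x \<in> set (c @ [hd c])" "y \<in> set (c @ [hd c])"
      then have "x \<in> set c" "y \<in> set c" using set_eq by auto
      moreover assume "(x \<rightarrow>\<^bsub>G\<^esub> y \<and> \<not> (\<exists>m\<in>set c. x \<rightarrow>\<^bsub>G\<^esub> m \<and> m \<rightarrow>\<^bsub>G\<^esub> y)) \<or>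
        (y \<rightarrow>\<^bsub>G\<^esub> x \<and> \<not> (\<exists>m\<in>set c. y \<rightarrow>\<^bsub>G\<^esub> m \<and> m \<rightarrow>\<^bsub>G\<^esub> x))"
      ultimately show "x \<rightarrow>\<^bsub>?T\<^esub> y \<or> y \<rightarrow>\<^bsub>?T\<^esub> x"
        using dominates_transitive_reduction[OF fill W] by blast
    qed
    ultimately show False
      using oriented_forest_no_cycle c by blast
  qed
qed

lemma dominates_mk_symmetric:
  "u \<rightarrow>\<^bsub>with_proj (mk_symmetric G)\<^esub> w \<longleftrightarrow> u \<rightarrow>\<^bsub>G\<^esub> w \<or> w \<rightarrow>\<^bsub>G\<^esub> u"
  by (auto simp: parcs_mk_symmetric arcs_ends_conv)

lemma ex_simplicial_source_or_sink:
  assumes "oriented_graph G" "skeletal G" "verts G \<noteq> {}"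
  shows "\<exists>z\<in>verts G. (source G z \<or> sink G z) \<and> simplicial G z"
proof -
  interpret oriented_graph G by fact
  interpret S: skeletal_relation "dominates G"
    by (rule skeletal_relation_dominates[OF assms(1,2)])
  obtain z where z: "S.good (verts G) z"
    using S.ex_good[OF finite_verts assms(3)] ..
  then have "simplicial G z"
    unfolding simplicial_def clique_def neighborhood_def S.good_def S.adj_def dominates_mk_symmetric
    by (auto dest: adj_in_verts)
  moreover have "source G z" if "\<forall>x\<in>verts G. \<not> x \<rightarrow>\<^bsub>G\<^esub> z"
  proof -
    have "e \<notin> in_arcs G z" for e
      using that tail_in_verts[of e] in_arcs_imp_in_arcs_ends[of e] by (auto simp: in_arcs_def)
    then show ?thesis unfolding source_def by blast
  qed
  moreover have "sink G z" if "\<forall>x\<in>verts G. \<not> z \<rightarrow>\<^bsub>G\<^esub> x"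
  proof -
    have "e \<notin> out_arcs G z" for e
      using that head_in_verts[of e] in_arcs_imp_in_arcs_ends[of e] by (auto simp: out_arcs_def)
    then show ?thesis unfolding sink_def by blast
  qed
  ultimately show ?thesis
    using z unfolding S.good_def by metis
qed

section \<open>Vertex deletion and the labeling\<close>

text \<open>Passes \<open>vertebrate\<close> on to vertex-deleted digraphs, as that property
  quantifies over all induced subgraphs.\<close>

lemma induced_subgraph_del_vert:
  assumes "wf_digraph G" "induced_subgraph H (pre_digraph.del_vert G z)"
  shows "induced_subgraph H G"
proof -
  interpret wf_digraph G by fact
  have "subgraph H G"
    using assms(2) subgraph_trans[OF _ subgraph_del_vert] by (auto simp: induced_subgraph_def)
  then show ?thesis
    using assms(2) by (auto simp: induced_subgraph_def subgraph_def del_vert_simps)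
qed

lemma oriented_graph_del_vert:
  assumes "oriented_graph G"
  shows "oriented_graph (pre_digraph.del_vert G z)"
proof -
  interpret oriented_graph G by fact
  interpret D: fin_digraph "del_vert z"
    by (rule fin_digraph_del_vert)
  have sub: "arcs_ends (del_vert z) \<subseteq> arcs_ends G"
    by (rule arcs_ends_mono[OF subgraph_del_vert])
  show ?thesis
    by unfold_locales
      (use no_loops no_multi_arcs in \<open>auto simp: arc_to_ends_def del_vert_simps
        dest!: subsetD[OF sub] no_antiparallel\<close>)
qed

lemma skeletal_del_vert:
  assumes "wf_digraph G" "skeletal G"
  shows "skeletal (pre_digraph.del_vert G z)"
proof -
  let ?D = "pre_digraph.del_vert G z"
  have dom: "u \<rightarrow>\<^bsub>?D\<^esub> w \<longleftrightarrow> u \<rightarrow>\<^bsub>G\<^esub> w \<and> u \<noteq> z \<and> w \<noteq> z" for u w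
    by (auto simp: arcs_ends_conv pre_digraph.del_vert_simps)
  have "vertebrate ?D"
    using assms induced_subgraph_del_vert[OF assms(1)] by (auto simp: skeletal_def vertebrate_def)
  moreover have "filled ?D"
    unfolding filled_def
  proof (intro allI impI, elim conjE)
    fix p i j
    assume p: "vpath p ?D" "hd p \<rightarrow>\<^bsub>?D\<^esub> last p" and ij: "i < j" "j < length p"
    \<comment> \<open>The arcs that \<open>filled\<close> supplies in \<open>G\<close> join vertices
      of \<open>p\<close>, so they survive the deletion of \<open>z\<close>.\<close>
    have "vpath p G" "z \<notin> set p"
      using p(1) dom by (auto simp: vpath_def vwalk_def pre_digraph.del_vert_simps)
    moreover from this have "p ! i \<noteq> z" "p ! j \<noteq> z"
      using ij nth_mem[of i p] nth_mem[of j p] by auto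
    ultimately show "p ! i \<rightarrow>\<^bsub>?D\<^esub> p ! j"
      using assms(2) p(2) ij dom by (auto simp: skeletal_def filled_def)
  qed
  ultimately show ?thesis
    by (simp add: skeletal_def)
qed

text \<open>Used to give the deleted vertex the top label: redefining a labeling at
  \<open>Suc n\<close> leaves the labels up to \<open>n\<close> intact.\<close>

lemma peo_consistent_labeling_cong:
  assumes "\<And>i. i \<in> {1..n} \<Longrightarrow> v i = w i"
  shows "peo_consistent_labeling n v G \<longleftrightarrow> peo_consistent_labeling n w G"
  using assms
proof (induction n arbitrary: G)
  case (Suc n)
  have "bij_betw v {1..Suc n} (verts G) \<longleftrightarrow> bij_betw w {1..Suc n} (verts G)"
    using Suc.prems by (intro bij_betw_cong) auto
  moreover have "v (Suc n) = w (Suc n)"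
    using Suc.prems by auto
  ultimately show ?case
    using Suc by auto
qed auto

theorem lemma25:
  fixes G :: "('a, 'b) pre_digraph"
  assumes "oriented_graph G"
    and "verts G \<noteq> {}"
    and "skeletal G"
  shows "peo_consistent G"
  using assms
proof (induction "card (verts G)" arbitrary: G rule: less_induct)
  case less
  interpret oriented_graph G by fact
  obtain z where z: "z \<in> verts G" "source G z \<or> sink G z" "simplicial G z"
    using ex_simplicial_source_or_sink less.prems by blast
  let ?D = "del_vert z"
  have card: "card (verts G) = Suc (card (verts ?D))"
    using z(1) by (simp add: del_vert_simps card_Suc_Diff1 del: card_Diff_insert)
  show ?case
  proof (cases "verts ?D = {}")
    \<comment> \<open>Here \<open>?D\<close> is empty and so not peo-consistent; a constant labeling
      of the single vertex serves instead.\<close>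
    case True
    then have "verts G = {z}"
      using z(1) by (auto simp: del_vert_simps)
    then show ?thesis
      by (auto simp: peo_consistent_def bij_betw_def intro!: exI[of _ "\<lambda>_. z"])
  next
    case False
    have "peo_consistent ?D"
      using less.hyps[of ?D] card False oriented_graph_del_vert[OF less.prems(1)]
        skeletal_del_vert[OF wf_digraph less.prems(3)] by simp
    then obtain v where v: "peo_consistent_labeling (card (verts ?D)) v ?D"
      by (auto simp: peo_consistent_def)
    let ?n = "card (verts ?D)"
    let ?w = "v(Suc ?n := z)"
    have "bij_betw v {1..?n} (verts ?D)"
      using v by (cases ?n) auto
    then have "bij_betw ?w {1..?n} (verts ?D)"
      by (subst bij_betw_cong[of _ _ v]) auto
    then have "bij_betw ?w (insert (Suc ?n) {1..?n}) (insert z (verts ?D))"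
      by (intro notIn_Un_bij_betw[of "Suc ?n" _ ?w "verts ?D", simplified])
        (auto simp: del_vert_simps)
    moreover have "insert (Suc ?n) {1..?n} = {1..Suc ?n}" "insert z (verts ?D) = verts G"
      using z(1) by (auto simp: del_vert_simps)
    moreover have "peo_consistent_labeling ?n ?w ?D"
      using v by (subst peo_consistent_labeling_cong[of _ _ v]) auto
    ultimately have "peo_consistent_labeling (Suc ?n) ?w G"
      using z by simp
    then show ?thesis
      unfolding peo_consistent_def card by blast
  qed
qed

end
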